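(* Consider the family of systems $$\frac{dx}{dt}=-\sum_{(p,q)\in S}a_{pq}x^{p+1}y^{q}=P(x,y),\qquad \frac{dy}{dt}=\sum_{(p,q)\in S}b_{qp}x^{q}y^{p+1}=Q(x,y)$$ with parameter space $E(a,b)=\mathbb{C}^{2\ell}$, and the group $U_\eta$ ($\eta\in\mathbb{C}\setminus\{0\}$) acting on $\mathbb{C}^{2\ell}$. (a) The set of the orbits of $U_\eta$ is divided into two disjoint subsets: the orbits in one subset together consist of all time-reversible systems and only time-reversible systems, and there are no time-reversible systems in the orbits of the other subset. (In other words, in each orbit of $U_\eta$ either every system is time-reversible or no system is time-reversible.) (b) The variety $\mathbf{V}(I_S)\subset\mathbb{C}^{2\ell}$ of the Sibirsky ideal $I_S$ is the Zariski closure of the union of all orbits of the group $U_\eta$ that are invariant under the involution $(a,b)\mapsto\widehat{(a,b)}$.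
   Context: Let $\mathbb{N}_0$ be the set of nonnegative integers and fix a finite set of $\ell$ distinct pairs $S=\{(p_j,q_j)\mid p_j+q_j\ge 0,\ j=1,\dots,\ell\}\subset(\{-1\}\cup\mathbb{N}_0)\times\mathbb{N}_0$. Write $(a,b)=(a_{p_1q_1},\dots,a_{p_\ell q_\ell},b_{q_\ell p_\ell},\dots,b_{q_1p_1})\in\mathbb{C}^{2\ell}$ for the ordered vector of coefficients (note the reversed order of the $b$'s); points of $E(a,b)=\mathbb{C}^{2\ell}$ are identified with systems of the family, and $\mathbb{C}[a,b]$ is the polynomial ring in the $2\ell$ variables $a_{p_jq_j},b_{q_jp_j}$. A system $(a,b)$ is time-reversible if it is time-reversible with respect to the map $x\mapsto\gamma y,\ y\mapsto\gamma^{-1}x$ for some nonzero $\gamma\in\mathbb{C}$, i.e. if for some nonzero $\gamma\in\mathbb{C}$ the polynomial identities $\gamma Q(\gamma y,x/\gamma)=-P(x,y)$ and $\gamma Q(x,y)=-P(\gamma y,x/\gamma)$ hold; equivalently, for some nonzero $\gamma\in\mathbb{C}$, $b_{qp}=\gamma^{p-q}a_{pq}$ for all $(p,q)\in S$. The phase space transformations $x'=\eta x,\ y'=\eta^{-1}y$ ($\eta\in\mathbb{C}$, $\eta\ne0$) induce on the coefficients the transformations $U_\eta:\mathbb{C}^{2\ell}\to\mathbb{C}^{2\ell}$, $U_\eta(a,b)=(a(\eta),b(\eta))$, where $a(\eta)_{p_kq_k}=a_{p_kq_k}\eta^{q_k-p_k}$ and $b(\eta)_{q_kp_k}=b_{q_kp_k}\eta^{p_k-q_k}$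 for $k=1,\dots,\ell$. "The group $U_\eta$" means the group $\{U_\eta\mid\eta\in\mathbb{C}\setminus\{0\}\}$, and orbits are orbits of its action on $\mathbb{C}^{2\ell}$. The involution of $(a,b)$ is $\widehat{(a,b)}=(b_{q_1p_1},\dots,b_{q_\ell p_\ell},a_{p_\ell q_\ell},\dots,a_{p_1q_1})$, i.e. the vector $(a,b)$ read in reverse order. An orbit $\mathcal{O}$ of $U_\eta$ is invariant under the involution if $\widehat{(a,b)}\in\mathcal{O}$ for every $(a,b)\in\mathcal{O}$. Let $\zeta=(p_1-q_1,\dots,p_\ell-q_\ell,q_\ell-p_\ell,\dots,q_1-p_1)\in\mathbb{Z}^{2\ell}$ and let $\mathcal{M}=\{\nu\in\mathbb{N}_0^{2\ell}\mid \zeta_1\nu_1+\cdots+\zeta_{2\ell}\nu_{2\ell}=0\}$. For $\nu\in\mathbb{N}_0^{2\ell}$ put $[\nu]=a_{p_1q_1}^{\nu_1}\cdots a_{p_\ell q_\ell}^{\nu_\ell}b_{q_\ell p_\ell}^{\nu_{\ell+1}}\cdots b_{q_1p_1}^{\nu_{2\ell}}$ and $\hat\nu=(\nu_{2\ell},\nu_{2\ell-1},\dots,\nu_1)$. The Sibirsky ideal is $I_S=\langle[\nu]-[\hat\nu]\mid\nu\in\mathcal{M}\rangle\subset\mathbb{C}[a,b]$. For an ideal $I\subset\mathbb{C}[a,b]$, $\mathbf{V}(I)\subset\mathbb{C}^{2\ell}$ is the set of common zeros of all polynomials of $I$. The Zariski closure of a subset of $\mathbb{C}^{2\ell}$ is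 the smallest such variety containing it. *)

theory Defs
  imports
    Complex_Main
    "HOL-Library.Poly_Mapping"
    "HOL-Algebra.Ideal"
    "HOL-Algebra.Group_Action"
    "Jordan_Normal_Form.Matrix"
begin

section \<open>Affine varieties in complex n-space\<close>

text \<open>
  A polynomial is a finitely supported map from monomials (finitely supported exponent
  functions on variable indices) to coefficients; the product of \<^theory>\<open>HOL-Library.Poly_Mapping\<close>
  is the convolution product. The variables of the ring in \<open>n\<close> indeterminates are \<open>0, ..., n - 1\<close>.
\<close>

type_synonym cpoly = "(nat \<Rightarrow>\<^sub>0 nat) \<Rightarrow>\<^sub>0 complex"

definition mpoly_ring :: "nat \<Rightarrow> cpoly ring" where
  "mpoly_ring n =
     \<lparr>carrier = {f. \<forall>m \<in> Poly_Mapping.keys f. Poly_Mapping.keys m \<subseteq> {..<n}},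
      monoid.mult = (*), one = 1, zero = 0, add = (+)\<rparr>"

definition eval_mpoly :: "cpoly \<Rightarrow> complex vec \<Rightarrow> complex" where
  "eval_mpoly f v =
     (\<Sum>m \<in> Poly_Mapping.keys f. Poly_Mapping.lookup f m *
        (\<Prod>i \<in> Poly_Mapping.keys m. (v $ i) ^ Poly_Mapping.lookup m i))"

definition variety :: "nat \<Rightarrow> cpoly set \<Rightarrow> complex vec set" where
  "variety n I = {v \<in> carrier_vec n. \<forall>f \<in> I. eval_mpoly f v = 0}"

definition is_variety :: "nat \<Rightarrow> complex vec set \<Rightarrow> bool" where
  "is_variety n V \<longleftrightarrow> (\<exists>I. ideal I (mpoly_ring n) \<and> V = variety n I)"

text \<open>
  The hull is the intersection of all varieties containing \<open>X\<close>; it is itself a variety, hence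
  the smallest one.
\<close>

definition zariski_closure :: "nat \<Rightarrow> complex vec set \<Rightarrow> complex vec set" where
  "zariski_closure n X = is_variety n hull X"

lemma cring_mpoly_ring: "cring (mpoly_ring n)"
proof (rule cringI)
  show "abelian_group (mpoly_ring n)"
  proof (rule abelian_groupI)
    fix f assume f: "f \<in> carrier (mpoly_ring n)"
    have "- f \<in> carrier (mpoly_ring n)"
      using f by (simp add: mpoly_ring_def)
    then show "\<exists>g \<in> carrier (mpoly_ring n). g \<oplus>\<^bsub>mpoly_ring n\<^esub> f = \<zero>\<^bsub>mpoly_ring n\<^esub>"
      by (intro bexI[of _ "- f"]) (simp_all add: mpoly_ring_def)
  qed (use keys_add in \<open>fastforce simp: mpoly_ring_def algebra_simps\<close>)+
  show "comm_monoid (mpoly_ring n)"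
  proof (rule comm_monoidI)
    fix f g assume f: "f \<in> carrier (mpoly_ring n)" and g: "g \<in> carrier (mpoly_ring n)"
    show "f \<otimes>\<^bsub>mpoly_ring n\<^esub> g \<in> carrier (mpoly_ring n)"
      unfolding mpoly_ring_def
    proof (simp, intro ballI)
      fix m assume "m \<in> Poly_Mapping.keys (f * g)"
      then obtain a b where "a \<in> Poly_Mapping.keys f" "b \<in> Poly_Mapping.keys g" "m = a + b"
        using keys_mult[of f g] by auto
      then show "Poly_Mapping.keys m \<subseteq> {..<n}"
        using f g keys_add[of a b] unfolding mpoly_ring_def by fastforce
    qed
  qed (simp_all add: mpoly_ring_def algebra_simps)
qed (simp add: mpoly_ring_def algebra_simps)


section \<open>The family of systems\<close>

text \<open>
  The ordered index set is a list \<open>S\<close> of \<open>\<ell>\<close> pairs \<open>(p, q)\<close>. A vector of length \<open>2\<ell>\<close> lists the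
  entries belonging to \<open>a\<close> in the order of \<open>S\<close>, followed by those belonging to \<open>b\<close> in reversed
  order. Positions count from 0, so the entries for the pair \<open>S ! k\<close> stand at positions \<open>k\<close>
  and \<open>2\<ell> - 1 - k\<close>.
\<close>

type_synonym index_list = "(int \<times> nat) list"

definition ab_vec :: "nat \<Rightarrow> (nat \<Rightarrow> 'a) \<Rightarrow> (nat \<Rightarrow> 'a) \<Rightarrow> 'a vec" where
  "ab_vec l a b = vec (2 * l) (\<lambda>i. if i < l then a i else b (2 * l - 1 - i))"

definition rev_vec :: "'a vec \<Rightarrow> 'a vec" where
  "rev_vec v = vec (dim_vec v) (\<lambda>i. v $ (dim_vec v - 1 - i))"

definition params :: "index_list \<Rightarrow> complex vec set" where
  "params S = carrier_vec (2 * length S)"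

definition a_coeff :: "index_list \<Rightarrow> complex vec \<Rightarrow> nat \<Rightarrow> complex" where
  "a_coeff S v k = v $ k"

definition b_coeff :: "index_list \<Rightarrow> complex vec \<Rightarrow> nat \<Rightarrow> complex" where
  "b_coeff S v k = v $ (2 * length S - 1 - k)"

definition sys_P :: "index_list \<Rightarrow> complex vec \<Rightarrow> complex \<Rightarrow> complex \<Rightarrow> complex" where
  "sys_P S v x y =
     - (\<Sum>k<length S. case S ! k of (p, q) \<Rightarrow> a_coeff S v k * x ^ nat (p + 1) * y ^ q)"

definition sys_Q :: "index_list \<Rightarrow> complex vec \<Rightarrow> complex \<Rightarrow> complex \<Rightarrow> complex" where
  "sys_Q S v x y =
     (\<Sum>k<length S. case S ! k of (p, q) \<Rightarrow> b_coeff S v k * x ^ q * y ^ nat (p + 1))"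

text \<open>Over the infinite field of complex numbers, polynomial identities are identities of functions.\<close>

definition time_reversible :: "index_list \<Rightarrow> complex vec \<Rightarrow> bool" where
  "time_reversible S v \<longleftrightarrow>
     (\<exists>\<gamma>. \<gamma> \<noteq> 0 \<and>
        (\<forall>x y. \<gamma> * sys_Q S v (\<gamma> * y) (x / \<gamma>) = - sys_P S v x y) \<and>
        (\<forall>x y. \<gamma> * sys_Q S v x y = - sys_P S v (\<gamma> * y) (x / \<gamma>)))"


section \<open>The group action\<close>

definition pq_diff :: "index_list \<Rightarrow> nat \<Rightarrow> int" where
  "pq_diff S k = (case S ! k of (p, q) \<Rightarrow> p - int q)"

definition U :: "index_list \<Rightarrow> complex \<Rightarrow> complex vec \<Rightarrow> complex vec" where
  "U S \<eta> = (\<lambda>v \<in> params S.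
     ab_vec (length S)
       (\<lambda>k. a_coeff S v k * \<eta> powi (- pq_diff S k))
       (\<lambda>k. b_coeff S v k * \<eta> powi pq_diff S k))"

definition U_group :: "index_list \<Rightarrow> (complex vec \<Rightarrow> complex vec) monoid" where
  "U_group S = (BijGroup (params S))\<lparr>carrier := {U S \<eta> | \<eta>. \<eta> \<noteq> 0}\<rparr>"

definition U_orbits :: "index_list \<Rightarrow> complex vec set set" where
  "U_orbits S = orbits (U_group S) (params S) (\<lambda>g. g)"

definition involution_invariant :: "complex vec set \<Rightarrow> bool" where
  "involution_invariant X \<longleftrightarrow> (\<forall>v \<in> X. rev_vec v \<in> X)"

lemma U_closed: "U S \<eta> v \<in> params S" if "v \<in> params S"
  using that by (simp add: U_def params_def ab_vec_def)

lemma U_U: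
  assumes "v \<in> params S" "\<eta> \<noteq> 0" "\<theta> \<noteq> 0"
  shows "U S \<eta> (U S \<theta> v) = U S (\<eta> * \<theta>) v"
proof -
  have "U S \<theta> v \<in> params S"
    using assms(1) by (rule U_closed)
  then show ?thesis
    using assms
    by (auto simp: U_def params_def ab_vec_def a_coeff_def b_coeff_def power_int_mult_distrib)
qed

lemma U_one: "U S 1 = (\<lambda>v \<in> params S. v)"
proof
  fix v show "U S 1 v = (\<lambda>v \<in> params S. v) v"
    by (auto simp: U_def params_def ab_vec_def a_coeff_def b_coeff_def intro!: eq_vecI)
qed

lemma U_Bij: "U S \<eta> \<in> Bij (params S)" if "\<eta> \<noteq> 0"
proof -
  have "bij_betw (U S \<eta>) (params S) (params S)"
    by (rule bij_betw_byWitness[where f' = "U S (inverse \<eta>)"])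
      (use that U_closed in \<open>auto simp: U_U U_one\<close>)
  then show ?thesis
    by (simp add: Bij_def U_def)
qed

lemma U_compose:
  assumes "\<eta> \<noteq> 0" "\<theta> \<noteq> 0"
  shows "U S \<eta> \<otimes>\<^bsub>BijGroup (params S)\<^esub> U S \<theta> = U S (\<eta> * \<theta>)"
proof -
  have "compose (params S) (U S \<eta>) (U S \<theta>) = U S (\<eta> * \<theta>)"
    by (rule extensionalityI[of _ "params S"])
      (use assms U_Bij[of "\<eta> * \<theta>" S] in \<open>auto simp: compose_eq U_U Bij_def\<close>)
  then show ?thesis
    using assms by (simp add: BijGroup_def U_Bij)
qed

lemma subgroup_U: "subgroup {U S \<eta> | \<eta>. \<eta> \<noteq> 0} (BijGroup (params S))"
proof -
  interpret B: group "BijGroup (params S)"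
    by (rule group_BijGroup)
  have one: "\<one>\<^bsub>BijGroup (params S)\<^esub> = U S 1"
    by (simp add: BijGroup_def U_one)
  have car: "U S \<eta> \<in> carrier (BijGroup (params S))" if "\<eta> \<noteq> 0" for \<eta>
    using U_Bij[OF that] by (simp add: BijGroup_def)
  have inv: "inv\<^bsub>BijGroup (params S)\<^esub> (U S \<eta>) = U S (inverse \<eta>)" if "\<eta> \<noteq> 0" for \<eta>
    using that by (intro B.inv_equality) (simp_all add: U_compose one car)
  show ?thesis
  proof (rule B.subgroupI)
    show "{U S \<eta> | \<eta>. \<eta> \<noteq> 0} \<subseteq> carrier (BijGroup (params S))"
      using car by blast
    have "U S 1 \<in> {U S \<eta> | \<eta>. \<eta> \<noteq> 0}"
      using zero_neq_one by (metis (mono_tags, lifting) mem_Collect_eq)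
    then show "{U S \<eta> | \<eta>. \<eta> \<noteq> 0} \<noteq> {}"
      by blast
  next
    fix f assume "f \<in> {U S \<eta> | \<eta>. \<eta> \<noteq> 0}"
    then obtain \<eta> where \<eta>: "\<eta> \<noteq> 0" "f = U S \<eta>" by blast
    show "inv\<^bsub>BijGroup (params S)\<^esub> f \<in> {U S \<eta> | \<eta>. \<eta> \<noteq> 0}"
      unfolding mem_Collect_eq by (rule exI[of _ "inverse \<eta>"]) (simp add: \<eta> inv)
  next
    fix f g assume "f \<in> {U S \<eta> | \<eta>. \<eta> \<noteq> 0}" "g \<in> {U S \<eta> | \<eta>. \<eta> \<noteq> 0}"
    then obtain \<eta> \<theta> where *: "\<eta> \<noteq> 0" "f = U S \<eta>" "\<theta> \<noteq> 0" "g = U S \<theta>" by blast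
    show "f \<otimes>\<^bsub>BijGroup (params S)\<^esub> g \<in> {U S \<eta> | \<eta>. \<eta> \<noteq> 0}"
      unfolding mem_Collect_eq by (rule exI[of _ "\<eta> * \<theta>"]) (simp add: * U_compose)
  qed
qed

lemma group_action_U: "group_action (U_group S) (params S) (\<lambda>g. g)"
proof -
  have "group (U_group S)"
    unfolding U_group_def
    using group.subgroup_imp_group[OF group_BijGroup subgroup_U] .
  then show ?thesis
    using subgroup.subset[OF subgroup_U, of S]
    by (auto simp: group_action_def group_hom_def group_hom_axioms_def group_BijGroup
        hom_def U_group_def)
qed


section \<open>The Sibirsky ideal\<close>

definition zeta :: "index_list \<Rightarrow> int vec" where
  "zeta S = ab_vec (length S) (\<lambda>k. pq_diff S k) (\<lambda>k. - pq_diff S k)"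

definition M_monoid :: "index_list \<Rightarrow> nat vec set" where
  "M_monoid S = {\<nu> \<in> carrier_vec (2 * length S). zeta S \<bullet> map_vec int \<nu> = 0}"

definition monomial :: "nat vec \<Rightarrow> cpoly" where
  "monomial \<nu> = Poly_Mapping.single (\<Sum>i<dim_vec \<nu>. Poly_Mapping.single i (\<nu> $ i)) 1"

definition sibirsky_ideal :: "index_list \<Rightarrow> cpoly set" where
  "sibirsky_ideal S =
     Idl\<^bsub>mpoly_ring (2 * length S)\<^esub> {monomial \<nu> - monomial (rev_vec \<nu>) | \<nu>. \<nu> \<in> M_monoid S}"

lemma sibirsky_generators:
  "{monomial \<nu> - monomial (rev_vec \<nu>) | \<nu>. \<nu> \<in> M_monoid S} \<subseteq> carrier (mpoly_ring (2 * length S))"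
proof -
  have key: "Poly_Mapping.keys m \<subseteq> {..<2 * length S}"
    if "m \<in> Poly_Mapping.keys (monomial \<nu>)" "dim_vec \<nu> = 2 * length S" for m and \<nu> :: "nat vec"
  proof -
    have "m = (\<Sum>i<2 * length S. Poly_Mapping.single i (\<nu> $ i))"
      using that by (simp add: monomial_def)
    then have "Poly_Mapping.keys m \<subseteq> (\<Union>i<2 * length S. Poly_Mapping.keys (Poly_Mapping.single i (\<nu> $ i)))"
      by (simp only: keys_sum)
    also have "\<dots> \<subseteq> {..<2 * length S}"
      by (rule UN_least) simp
    finally show ?thesis .
  qed
  show ?thesis
  proof (clarify)
    fix \<nu> assume "\<nu> \<in> M_monoid S"
    then have "dim_vec \<nu> = 2 * length S" "dim_vec (rev_vec \<nu>) = 2 * length S"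
      by (auto simp: M_monoid_def rev_vec_def)
    then show "monomial \<nu> - monomial (rev_vec \<nu>) \<in> carrier (mpoly_ring (2 * length S))"
      using key keys_diff[of "monomial \<nu>" "monomial (rev_vec \<nu>)"]
      unfolding mpoly_ring_def partial_object.simps by blast
  qed
qed

end

theory Submission
  imports Defs
begin

text \<open>
  Put \<open>z\<^sub>k = p\<^sub>k - q\<^sub>k\<close>. Comparing coefficients, a system is time-reversible iff
  \<open>b\<^sub>k = \<gamma>\<^bsup>z\<^sub>k\<^esup> a\<^sub>k\<close> for all \<open>k\<close> and some \<open>\<gamma> \<noteq> 0\<close>. This says that \<open>U\<^sub>\<eta>\<close> with \<open>\<eta> = 1/\<gamma>\<close> maps the
  system to its involution, so the invariant orbits are exactly the orbits of time-reversible
  systems.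

  The set \<open>T\<close> of time-reversible systems is a monoid under entrywise multiplication, and
  monomials are characters of it. By Dedekind's independence of characters, a polynomial
  vanishes on \<open>T\<close> only if its coefficients add up to zero over every class of monomials that
  agree on \<open>T\<close>. Two such monomials \<open>[\<mu>]\<close>, \<open>[\<nu>]\<close> can be written as \<open>[\<rho>][\<sigma>]\<close> and \<open>[\<rho>][\<sigma>']\<close>
  with \<open>\<sigma> \<in> M\<close> and \<open>\<sigma>'\<close> the reversal of \<open>\<sigma>\<close>, so they also agree on the variety of the Sibirsky
  ideal.
\<close>

section \<open>Independence of characters\<close>

text \<open>Dedekind's elimination: the relation at \<open>op y x\<close> minus
  \<open>\<chi> j y\<close> times the relation at \<open>x\<close> no longer involves
  \<open>j\<close>, and a \<open>y\<close> separating \<open>i\<close> from \<open>j\<close> keeps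
  the new coefficient of \<open>i\<close> a nonzero multiple of \<open>c i\<close>. Since
  \<open>\<chi> j\<close> does not vanish at \<open>e\<close>, the relation at \<open>e\<close>
  finally kills \<open>c j\<close>.\<close>

lemma characters_independent:
  fixes \<chi> :: "'i \<Rightarrow> 'g \<Rightarrow> 'b::field"
  assumes "finite I"
    and closed: "\<And>x y. x \<in> T \<Longrightarrow> y \<in> T \<Longrightarrow> op x y \<in> T"
    and mult: "\<And>i x y. i \<in> I \<Longrightarrow> x \<in> T \<Longrightarrow> y \<in> T \<Longrightarrow> \<chi> i (op x y) = \<chi> i x * \<chi> i y"
    and e: "e \<in> T" "\<And>i. i \<in> I \<Longrightarrow> \<chi> i e \<noteq> 0"
    and inj: "\<And>i j. i \<in> I \<Longrightarrow> j \<in> I \<Longrightarrow> i \<noteq> j \<Longrightarrow> \<exists>x \<in> T. \<chi> i x \<noteq> \<chi> j x"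
    and "\<And>x. x \<in> T \<Longrightarrow> (\<Sum>i \<in> I. c i * \<chi> i x) = 0"
    and "i \<in> I"
  shows "c i = 0"
  using assms(1) mult e(2) inj assms(7,8)
proof (induction I arbitrary: c i rule: finite_induct)
  case empty
  then show ?case by simp
next
  case (insert j I)
  have zero: "c i = 0" if i: "i \<in> I" for i
  proof -
    obtain y where y: "y \<in> T" "\<chi> i y \<noteq> \<chi> j y"
      using insert.prems(3)[of i j] insert.hyps i by auto
    have "(\<Sum>i \<in> I. c i * (\<chi> i y - \<chi> j y) * \<chi> i x) = 0" if x: "x \<in> T" for x
    proof -
      have "(\<Sum>i \<in> insert j I. c i * \<chi> i (op y x)) - \<chi> j y * (\<Sum>i \<in> insert j I. c i * \<chi> i x) = 0"
        using insert.prems(4)[OF x] insert.prems(4)[OF closed[OF y(1) x]] by simp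
      also have "(\<Sum>i \<in> insert j I. c i * \<chi> i (op y x)) = (\<Sum>i \<in> insert j I. c i * (\<chi> i y * \<chi> i x))"
        using insert.prems(1) x y by (intro sum.cong) auto
      finally show ?thesis
        using insert.hyps
        by (simp add: algebra_simps sum_distrib_left sum_subtractf)
    qed
    then have "c i * (\<chi> i y - \<chi> j y) = 0"
      using insert.IH[of "\<lambda>i. c i * (\<chi> i y - \<chi> j y)" i] insert.prems i by auto
    with y show ?thesis by simp
  qed
  have "c j * \<chi> j e = 0"
    using insert.prems(4)[OF e(1)] insert.hyps zero by simp
  then show ?case
    using zero insert.prems(2,5) by auto
qed

text \<open>Bivariate monomials are characters of the plane under entrywise multiplication,
  separated by the points (2, 1) and (1, 2). This justifies comparing coefficients in identities of
  functions.\<close>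

lemma monomial_sum_eq_zero:
  fixes c :: "'i \<Rightarrow> complex" and m n :: "'i \<Rightarrow> nat"
  assumes "finite I" "inj_on (\<lambda>i. (m i, n i)) I"
    and "\<And>x y. (\<Sum>i \<in> I. c i * (x ^ m i * y ^ n i)) = 0"
    and "i \<in> I"
  shows "c i = 0"
proof (rule characters_independent[where T = UNIV and e = "(1, 1)"
      and op = "\<lambda>u v. (fst u * fst v, snd u * snd v)"
      and \<chi> = "\<lambda>i (x, y). x ^ m i * y ^ n i"])
  fix i j assume "i \<in> I" "j \<in> I" "i \<noteq> j"
  then have "m i \<noteq> m j \<or> n i \<noteq> n j"
    using assms(2) by (auto simp: inj_on_def)
  then show "\<exists>x \<in> UNIV. (case x of (x, y) \<Rightarrow> x ^ m i * y ^ n i) \<noteq>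
      (case x of (x, y) \<Rightarrow> (x::complex) ^ m j * y ^ n j)"
  proof
    assume "m i \<noteq> m j"
    then have "(2::nat) ^ m i \<noteq> 2 ^ m j" by simp
    then have "(2::complex) ^ m i \<noteq> 2 ^ m j"
      by (metis of_nat_eq_iff of_nat_numeral of_nat_power)
    then show ?thesis by (intro bexI[of _ "(2, 1)"]) auto
  next
    assume "n i \<noteq> n j"
    then have "(2::nat) ^ n i \<noteq> 2 ^ n j" by simp
    then have "(2::complex) ^ n i \<noteq> 2 ^ n j"
      by (metis of_nat_eq_iff of_nat_numeral of_nat_power)
    then show ?thesis by (intro bexI[of _ "(1, 2)"]) auto
  qed
qed (use assms in \<open>auto simp: algebra_simps power_mult_distrib split: prod.splits\<close>)


section \<open>Polynomials and varieties\<close>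

lemma poly_mapping_single_induct [case_names zero single]:
  fixes f :: "'a \<Rightarrow>\<^sub>0 'b::comm_monoid_add"
  assumes "P 0"
    and "\<And>f m c. P f \<Longrightarrow> P (Poly_Mapping.single m c + f)"
  shows "P f"
proof (induction f rule: update_induct)
  case const
  show ?case by (rule assms(1))
next
  case (update f m c)
  then have "Poly_Mapping.update m c f = Poly_Mapping.single m c + f"
    by (intro poly_mapping_eqI)
      (auto simp: lookup_update lookup_add lookup_single when_def in_keys_iff)
  then show ?case
    using assms(2)[OF update(3)] by simp
qed

section \<open>Evaluation as a ring homomorphism\<close>

definition power_product :: "(nat \<Rightarrow>\<^sub>0 nat) \<Rightarrow> complex vec \<Rightarrow> complex" where
  "power_product m v = (\<Prod>i \<in> Poly_Mapping.keys m. (v $ i) ^ Poly_Mapping.lookup m i)"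

text \<open>Variables outside the support contribute a factor 1, so several monomials can be
  evaluated over one common index set.\<close>

lemma power_product_superset:
  assumes "finite A" "Poly_Mapping.keys m \<subseteq> A"
  shows "power_product m v = (\<Prod>i \<in> A. (v $ i) ^ Poly_Mapping.lookup m i)"
  unfolding power_product_def
  by (intro prod.mono_neutral_left assms) (auto simp: in_keys_iff)

lemma power_product_add: "power_product (m + n) v = power_product m v * power_product n v"
proof -
  let ?A = "Poly_Mapping.keys m \<union> Poly_Mapping.keys n"
  have "Poly_Mapping.keys (m + n) \<subseteq> ?A" by (rule keys_add)
  then show ?thesis
    by (simp add: power_product_superset[of ?A] lookup_add power_add prod.distrib)
qed

lemma eval_mpoly_superset:
  assumes "finite A" "Poly_Mapping.keys f \<subseteq> A"
  shows "eval_mpoly f v = (\<Sum>m \<in> A. Poly_Mapping.lookup f m * power_product m v)"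
  unfolding eval_mpoly_def power_product_def
  by (intro sum.mono_neutral_left assms) (auto simp: in_keys_iff)

lemma eval_mpoly_zero [simp]: "eval_mpoly 0 v = 0"
  by (simp add: eval_mpoly_def)

lemma eval_mpoly_single: "eval_mpoly (Poly_Mapping.single m c) v = c * power_product m v"
  by (simp add: eval_mpoly_superset[of "{m}"])

lemma eval_mpoly_add: "eval_mpoly (f + g) v = eval_mpoly f v + eval_mpoly g v"
proof -
  let ?A = "Poly_Mapping.keys f \<union> Poly_Mapping.keys g"
  have "Poly_Mapping.keys (f + g) \<subseteq> ?A" by (rule keys_add)
  then show ?thesis
    by (simp add: eval_mpoly_superset[of ?A] lookup_add sum.distrib algebra_simps)
qed

lemma eval_mpoly_uminus: "eval_mpoly (- f) v = - eval_mpoly f v"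
  using eval_mpoly_add[of f "- f" v] by (simp add: eq_neg_iff_add_eq_0 add.commute)

lemma eval_mpoly_diff: "eval_mpoly (f - g) v = eval_mpoly f v - eval_mpoly g v"
  using eval_mpoly_add[of f "- g" v] by (simp add: eval_mpoly_uminus)

text \<open>Adding one term at a time in each factor reduces the claim to a product of two single
  terms.\<close>

lemma eval_mpoly_mult: "eval_mpoly (f * g) v = eval_mpoly f v * eval_mpoly g v"
proof (induction f rule: poly_mapping_single_induct)
  case (single f m c)
  have "eval_mpoly (Poly_Mapping.single m c * g) v = c * power_product m v * eval_mpoly g v"
  proof (induction g rule: poly_mapping_single_induct)
    case (single g n d)
    then show ?case
      by (simp add: distrib_left mult_single eval_mpoly_add eval_mpoly_single power_product_add)
  qed simp
  with single show ?case
    by (simp add: distrib_right eval_mpoly_add eval_mpoly_single)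
qed simp

section \<open>Ideals of polynomials vanishing at a point\<close>

lemma vanishing_ideal: "ideal {f \<in> carrier (mpoly_ring n). eval_mpoly f v = 0} (mpoly_ring n)"
proof -
  interpret R: cring "mpoly_ring n" by (rule cring_mpoly_ring)
  have a_inv: "\<ominus>\<^bsub>mpoly_ring n\<^esub> f = - f" if "f \<in> carrier (mpoly_ring n)" for f
    using that by (intro R.minus_equality) (auto simp: mpoly_ring_def)
  show ?thesis
  proof (rule idealI)
    show "subgroup {f \<in> carrier (mpoly_ring n). eval_mpoly f v = 0} (add_monoid (mpoly_ring n))"
    proof (rule R.add.subgroupI)
      show "{f \<in> carrier (mpoly_ring n). eval_mpoly f v = 0} \<noteq> {}"
        by (auto intro!: exI[of _ 0] simp: mpoly_ring_def)
    next
      fix f assume "f \<in> {f \<in> carrier (mpoly_ring n). eval_mpoly f v = 0}"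
      then show "\<ominus>\<^bsub>mpoly_ring n\<^esub> f \<in> {f \<in> carrier (mpoly_ring n). eval_mpoly f v = 0}"
        using R.a_inv_closed[of f] by (simp add: a_inv eval_mpoly_uminus)
    next
      fix f g assume "f \<in> {f \<in> carrier (mpoly_ring n). eval_mpoly f v = 0}"
        "g \<in> {f \<in> carrier (mpoly_ring n). eval_mpoly f v = 0}"
      then show "f \<oplus>\<^bsub>mpoly_ring n\<^esub> g \<in> {f \<in> carrier (mpoly_ring n). eval_mpoly f v = 0}"
        using R.a_closed[of f g] by (simp add: mpoly_ring_def eval_mpoly_add)
    qed auto
  next
    fix f g assume "f \<in> {f \<in> carrier (mpoly_ring n). eval_mpoly f v = 0}"
      "g \<in> carrier (mpoly_ring n)"
    then show "g \<otimes>\<^bsub>mpoly_ring n\<^esub> f \<in> {f \<in> carrier (mpoly_ring n). eval_mpoly f v = 0}"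
      and "f \<otimes>\<^bsub>mpoly_ring n\<^esub> g \<in> {f \<in> carrier (mpoly_ring n). eval_mpoly f v = 0}"
      using R.m_closed[of f g] R.m_closed[of g f] by (simp_all add: mpoly_ring_def eval_mpoly_mult)
  qed (rule R.ring_axioms)
qed

text \<open>If all of \<open>G\<close> vanishes at \<open>v\<close>, the vanishing ideal of
  \<open>v\<close> contains \<open>G\<close> and hence the ideal generated by
  \<open>G\<close>.\<close>

lemma variety_genideal:
  assumes "G \<subseteq> carrier (mpoly_ring n)"
  shows "variety n (Idl\<^bsub>mpoly_ring n\<^esub> G) = variety n G"
proof -
  interpret R: cring "mpoly_ring n" by (rule cring_mpoly_ring)
  have "eval_mpoly f v = 0"
    if "v \<in> variety n G" "f \<in> Idl\<^bsub>mpoly_ring n\<^esub> G" for f v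
    using R.genideal_minimal[OF vanishing_ideal[of n v], of G] assms that
    by (auto simp: variety_def)
  then show ?thesis
    using R.genideal_self[OF assms] by (auto simp: variety_def)
qed

section \<open>Polynomials vanishing on a submonoid of complex n-space\<close>

definition hadamard :: "complex vec \<Rightarrow> complex vec \<Rightarrow> complex vec" where
  "hadamard u v = vec (dim_vec u) (\<lambda>i. u $ i * v $ i)"

text \<open>Exponents are plain functions, so that those of polynomial terms and those given by
  vectors are treated alike.\<close>

definition monomial_value :: "nat \<Rightarrow> (nat \<Rightarrow> nat) \<Rightarrow> complex vec \<Rightarrow> complex" where
  "monomial_value n e v = (\<Prod>i<n. (v $ i) ^ e i)"

text \<open>
  The Zariski closure of a submonoid of \<open>\<complex>\<^sup>n\<close> is cut out by the binomials vanishing on it.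
\<close>

lemma eval_mpoly_zero_if_zero_on_monoid:
  assumes T: "T \<subseteq> carrier_vec n" "vec n (\<lambda>_. 1) \<in> T" "\<And>u v. u \<in> T \<Longrightarrow> v \<in> T \<Longrightarrow> hadamard u v \<in> T"
    and f: "f \<in> carrier (mpoly_ring n)" "\<And>u. u \<in> T \<Longrightarrow> eval_mpoly f u = 0"
    and v: "\<And>e d. (\<And>u. u \<in> T \<Longrightarrow> monomial_value n e u = monomial_value n d u) \<Longrightarrow>
      monomial_value n e v = monomial_value n d v"
  shows "eval_mpoly f v = 0"
proof -
  \<comment> \<open>Restricting to \<open>T\<close> gives all these functions the same default value
    off \<open>T\<close>, so \<open>\<chi>\<close> identifies exactly the monomials that agree on
    \<open>T\<close>.\<close>
  define \<chi> where "\<chi> m = restrict (monomial_value n (Poly_Mapping.lookup m)) T" for m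
  let ?K = "Poly_Mapping.keys f"
  define c where "c X = (\<Sum>m | m \<in> ?K \<and> \<chi> m = X. Poly_Mapping.lookup f m)" for X
  have eval: "eval_mpoly f u =
      (\<Sum>m \<in> ?K. Poly_Mapping.lookup f m * monomial_value n (Poly_Mapping.lookup m) u)" for u
    using f(1) unfolding eval_mpoly_superset[OF finite_keys order_refl]
    by (intro sum.cong refl) (auto simp: monomial_value_def mpoly_ring_def power_product_superset)
  \<comment> \<open>This regrouping applies to any values \<open>h\<close> constant on the classes
    of \<open>\<chi>\<close>: first to values at a point of \<open>T\<close>, later to values at
    \<open>v\<close>.\<close>
  have group: "(\<Sum>m \<in> ?K. Poly_Mapping.lookup f m * h m) = (\<Sum>X \<in> \<chi> ` ?K. c X * g X)"
    if "\<And>m. m \<in> ?K \<Longrightarrow> h m = g (\<chi> m)" for h :: "_ \<Rightarrow> complex" and g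
  proof -
    have "(\<Sum>m \<in> ?K. Poly_Mapping.lookup f m * h m) =
        (\<Sum>X \<in> \<chi> ` ?K. \<Sum>m | m \<in> ?K \<and> \<chi> m = X. Poly_Mapping.lookup f m * h m)"
      by (rule sum.image_gen) simp
    also have "\<dots> = (\<Sum>X \<in> \<chi> ` ?K. c X * g X)"
      unfolding c_def sum_distrib_right using that by (intro sum.cong refl) auto
    finally show ?thesis .
  qed
  \<comment> \<open>The characters themselves serve as indices, so different indices differ
    somewhere on \<open>T\<close>.\<close>
  have c0: "c X = 0" if "X \<in> \<chi> ` ?K" for X
  proof (rule characters_independent[where I = "\<chi> ` ?K" and T = T and op = hadamard
        and e = "vec n (\<lambda>_. 1)" and \<chi> = "\<lambda>X. X" and c = c and i = X])
    fix X u w assume "X \<in> \<chi> ` ?K" "u \<in> T" "w \<in> T"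
    moreover from this T(1) have "dim_vec u = n" by auto
    ultimately show "X (hadamard u w) = X u * X w"
      using T(3)[of u w]
      by (auto simp: \<chi>_def monomial_value_def hadamard_def power_mult_distrib prod.distrib)
  next
    fix X assume "X \<in> \<chi> ` ?K"
    then show "X (vec n (\<lambda>_. 1)) \<noteq> 0"
      using T(2) by (auto simp: \<chi>_def monomial_value_def)
  next
    fix X Y assume "X \<in> \<chi> ` ?K" "Y \<in> \<chi> ` ?K" "X \<noteq> Y"
    then show "\<exists>x \<in> T. X x \<noteq> Y x"
      unfolding \<chi>_def by (metis (no_types, lifting) ext image_iff restrict_def)
  next
    fix u assume u: "u \<in> T"
    show "(\<Sum>X \<in> \<chi> ` ?K. c X * X u) = 0"
      using f(2)[OF u] u unfolding eval
      by (subst group[symmetric, where h = "\<lambda>m. monomial_value n (Poly_Mapping.lookup m) u"])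
        (auto simp: \<chi>_def)
  qed (use T that in auto)
  \<comment> \<open>The value at \<open>v\<close> of a chosen representative of the class; by the
    hypothesis on \<open>v\<close> it does not depend on the choice.\<close>
  define g where
    "g X = monomial_value n (Poly_Mapping.lookup (SOME m. \<chi> m = X)) v" for X
  have "monomial_value n (Poly_Mapping.lookup m) v = g (\<chi> m)" for m
  proof -
    have "\<chi> (SOME m'. \<chi> m' = \<chi> m) = \<chi> m" by (rule someI) simp
    then show ?thesis
      unfolding g_def \<chi>_def
      by (intro v) (metis (no_types, lifting) restrict_apply')
  qed
  then have "eval_mpoly f v = (\<Sum>X \<in> \<chi> ` ?K. c X * g X)"
    unfolding eval by (intro group)
  then show ?thesis using c0 by simp
qed

lemma eval_monomial:
  "eval_mpoly (monomial \<nu>) v = monomial_value (dim_vec \<nu>) (\<lambda>i. \<nu> $ i) v"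
proof -
  let ?m = "\<Sum>i<dim_vec \<nu>. Poly_Mapping.single i (\<nu> $ i)"
  have lookup: "Poly_Mapping.lookup ?m j = (if j < dim_vec \<nu> then \<nu> $ j else 0)" for j
    by (simp add: lookup_sum lookup_single when_def)
  then have "Poly_Mapping.keys ?m \<subseteq> {..<dim_vec \<nu>}"
    by (auto simp: in_keys_iff split: if_splits)
  then show ?thesis
    by (simp add: monomial_def eval_mpoly_single power_product_superset[of "{..<dim_vec \<nu>}"]
        lookup monomial_value_def)
qed


section \<open>Time-reversible systems and invariant orbits\<close>

definition reversible_set :: "index_list \<Rightarrow> complex vec set" where
  "reversible_set S = {v \<in> params S.
     \<exists>\<gamma>. \<gamma> \<noteq> 0 \<and> (\<forall>k<length S. b_coeff S v k = \<gamma> powi pq_diff S k * a_coeff S v k)}"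

text \<open>The coefficients of \<open>x^q y^(p+1)\<close> in the second defining identity give the
  condition, and the condition gives that identity back.\<close>

lemma time_reversible_iff:
  assumes "distinct S" and "\<forall>(p, q) \<in> set S. p \<ge> -1 \<and> p + int q \<ge> 0"
  shows "time_reversible S v \<longleftrightarrow>
    (\<exists>\<gamma>. \<gamma> \<noteq> 0 \<and> (\<forall>k<length S. b_coeff S v k = \<gamma> powi pq_diff S k * a_coeff S v k))"
proof -
  let ?l = "length S"
  define m where "m k = nat (fst (S ! k) + 1)" for k
  define n where "n k = snd (S ! k)" for k
  have p: "fst (S ! k) \<ge> -1" if "k < ?l" for k
    using assms(2) nth_mem[OF that] by (auto simp: case_prod_unfold)
  \<comment> \<open>As \<open>p \<ge> -1\<close>, the conversion to \<open>nat\<close> loses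
    nothing, so distinct pairs yield distinct monomials.\<close>
  have inj: "inj_on (\<lambda>k. (n k, m k)) {..<?l}"
  proof (rule inj_onI)
    fix j k assume jk: "j \<in> {..<?l}" "k \<in> {..<?l}" "(n j, m j) = (n k, m k)"
    then have "S ! j = S ! k"
      using p[of j] p[of k] by (auto simp: m_def n_def prod_eq_iff)
    with jk assms(1) show "j = k" by (simp add: nth_eq_iff_index_eq)
  qed
  have diff: "pq_diff S k = int (m k) - 1 - int (n k)" if "k < ?l" for k
    using p[OF that] by (simp add: pq_diff_def m_def n_def case_prod_unfold)
  have P: "sys_P S v x y = - (\<Sum>k<?l. a_coeff S v k * x ^ m k * y ^ n k)" for x y
    by (simp add: sys_P_def m_def n_def case_prod_unfold)
  have Q: "sys_Q S v x y = (\<Sum>k<?l. b_coeff S v k * x ^ n k * y ^ m k)" for x y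
    by (simp add: sys_Q_def m_def n_def case_prod_unfold)
  \<comment> \<open>The factor \<open>\<gamma>\<close> in front of \<open>Q\<close> turns the
    possibly negative exponent \<open>p - q\<close> into a quotient of natural powers.\<close>
  have powi: "\<gamma> * \<gamma> powi pq_diff S k = \<gamma> ^ m k / \<gamma> ^ n k" if "k < ?l" "\<gamma> \<noteq> 0" for \<gamma> :: complex and k
    using that by (simp add: diff power_int_diff)
  show ?thesis
  proof
    assume "time_reversible S v"
    then obtain \<gamma> where \<gamma>: "\<gamma> \<noteq> 0"
      "\<And>x y. \<gamma> * sys_Q S v x y = - sys_P S v (\<gamma> * y) (x / \<gamma>)"
      unfolding time_reversible_def by blast
    have "\<gamma> * b_coeff S v k - a_coeff S v k * (\<gamma> ^ m k / \<gamma> ^ n k) = 0" if "k < ?l" for k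
    proof (rule monomial_sum_eq_zero[where I = "{..<?l}" and m = n and n = m and i = k and
          c = "\<lambda>k. \<gamma> * b_coeff S v k - a_coeff S v k * (\<gamma> ^ m k / \<gamma> ^ n k)"])
      fix x y :: complex
      have "(\<Sum>k<?l. \<gamma> * b_coeff S v k * (x ^ n k * y ^ m k)) =
          (\<Sum>k<?l. a_coeff S v k * (\<gamma> ^ m k / \<gamma> ^ n k) * (x ^ n k * y ^ m k))"
        using \<gamma>(2)[of x y]
        by (simp add: P Q sum_distrib_left power_mult_distrib power_divide mult_ac)
      then show "(\<Sum>k<?l. (\<gamma> * b_coeff S v k - a_coeff S v k * (\<gamma> ^ m k / \<gamma> ^ n k)) *
          (x ^ n k * y ^ m k)) = 0"
        by (simp only: left_diff_distrib sum_subtractf diff_self)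
    qed (use inj that in auto)
    then have "\<gamma> * b_coeff S v k = \<gamma> * (\<gamma> powi pq_diff S k * a_coeff S v k)" if "k < ?l" for k
      using powi[OF that \<gamma>(1)] that by (simp add: mult.assoc[symmetric])
    with \<gamma>(1) show "\<exists>\<gamma>. \<gamma> \<noteq> 0 \<and>
        (\<forall>k<?l. b_coeff S v k = \<gamma> powi pq_diff S k * a_coeff S v k)"
      by (intro exI[of _ \<gamma>]) simp
  next
    assume "\<exists>\<gamma>. \<gamma> \<noteq> 0 \<and> (\<forall>k<?l. b_coeff S v k = \<gamma> powi pq_diff S k * a_coeff S v k)"
    then obtain \<gamma> where \<gamma>: "\<gamma> \<noteq> 0"
      "\<And>k. k < ?l \<Longrightarrow> b_coeff S v k = \<gamma> powi pq_diff S k * a_coeff S v k"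
      by blast
    have b: "\<gamma> * b_coeff S v k = \<gamma> ^ m k / \<gamma> ^ n k * a_coeff S v k" if "k < ?l" for k
      using \<gamma>(2)[OF that] powi[OF that \<gamma>(1)] by (simp add: mult.assoc[symmetric])
    have eq: "\<gamma> * sys_Q S v x y = - sys_P S v (\<gamma> * y) (x / \<gamma>)" for x y
      unfolding P Q minus_minus sum_distrib_left
    proof (intro sum.cong refl)
      fix k assume "k \<in> {..<?l}"
      then show "\<gamma> * (b_coeff S v k * x ^ n k * y ^ m k) =
          a_coeff S v k * (\<gamma> * y) ^ m k * (x / \<gamma>) ^ n k"
        using b[of k] \<gamma>(1)
        by (simp add: mult.assoc[symmetric]) (simp add: power_mult_distrib power_divide)
    qed
    \<comment> \<open>The first identity is the second one at
      \<open>(\<gamma> * y, x / \<gamma>)\<close>, since the substitution is an involution.\<close>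
    from eq[of "\<gamma> * y" "x / \<gamma>" for x y] eq \<gamma>(1) show "time_reversible S v"
      unfolding time_reversible_def by (intro exI[of _ \<gamma>]) simp
  qed
qed

lemma Collect_time_reversible:
  assumes "distinct S" and "\<forall>(p, q) \<in> set S. p \<ge> -1 \<and> p + int q \<ge> 0"
  shows "{v \<in> params S. time_reversible S v} = reversible_set S"
  using time_reversible_iff[OF assms] by (auto simp: reversible_set_def)

section \<open>The action and the involution in coordinates; orbits\<close>

lemma coeff_U:
  assumes "v \<in> params S" "k < length S"
  shows "a_coeff S (U S \<eta> v) k = a_coeff S v k * \<eta> powi (- pq_diff S k)"
    and "b_coeff S (U S \<eta> v) k = b_coeff S v k * \<eta> powi pq_diff S k"
  using assms by (auto simp: U_def ab_vec_def a_coeff_def b_coeff_def)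

lemma coeff_rev_vec:
  assumes "v \<in> params S" "k < length S"
  shows "a_coeff S (rev_vec v) k = b_coeff S v k" and "b_coeff S (rev_vec v) k = a_coeff S v k"
  using assms by (auto simp: rev_vec_def params_def a_coeff_def b_coeff_def)

lemma params_eqI:
  assumes "v \<in> params S" "w \<in> params S"
    and a: "\<And>k. k < length S \<Longrightarrow> a_coeff S v k = a_coeff S w k"
    and b: "\<And>k. k < length S \<Longrightarrow> b_coeff S v k = b_coeff S w k"
  shows "v = w"
proof (rule eq_vecI)
  fix i assume "i < dim_vec w"
  then have i: "i < 2 * length S" using assms(2) by (simp add: params_def)
  show "v $ i = w $ i"
  proof (cases "i < length S")
    case True
    then show ?thesis using a[of i] by (simp add: a_coeff_def)
  next
    case False
    then have "2 * length S - 1 - (2 * length S - 1 - i) = i" "2 * length S - 1 - i < length S"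
      using i by auto
    then show ?thesis using b[of "2 * length S - 1 - i"] unfolding b_coeff_def by simp
  qed
qed (use assms in \<open>auto simp: params_def\<close>)

lemma rev_vec_params: "v \<in> params S \<Longrightarrow> rev_vec v \<in> params S"
  by (auto simp: params_def rev_vec_def)

text \<open>The a-entries of \<open>rev_vec v = U S \<eta> v\<close> say that each b-coefficient is
  \<open>\<eta>\<close> to the power \<open>q - p\<close> times its a-coefficient, which is
  reversibility with \<open>\<gamma> = 1/\<eta>\<close>. The b-entries say the same.\<close>

lemma reversible_iff_rev_in_orbit:
  assumes "v \<in> params S"
  shows "v \<in> reversible_set S \<longleftrightarrow> (\<exists>\<eta>. \<eta> \<noteq> 0 \<and> rev_vec v = U S \<eta> v)"
proof
  assume "v \<in> reversible_set S"
  then obtain \<gamma> where \<gamma>: "\<gamma> \<noteq> 0"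
    "\<And>k. k < length S \<Longrightarrow> b_coeff S v k = \<gamma> powi pq_diff S k * a_coeff S v k"
    by (auto simp: reversible_set_def)
  have "rev_vec v = U S (inverse \<gamma>) v"
    by (rule params_eqI[of _ S])
      (use assms \<gamma> in \<open>auto simp: rev_vec_params U_closed coeff_U coeff_rev_vec
        power_int_minus power_int_inverse\<close>)
  with \<gamma>(1) show "\<exists>\<eta>. \<eta> \<noteq> 0 \<and> rev_vec v = U S \<eta> v"
    by (intro exI[of _ "inverse \<gamma>"]) simp
next
  assume "\<exists>\<eta>. \<eta> \<noteq> 0 \<and> rev_vec v = U S \<eta> v"
  then obtain \<eta> where \<eta>: "\<eta> \<noteq> 0" "rev_vec v = U S \<eta> v" by blast
  have "b_coeff S v k = inverse \<eta> powi pq_diff S k * a_coeff S v k" if "k < length S" for k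
    using coeff_rev_vec(1)[OF assms that] coeff_U(1)[OF assms that, of \<eta>] \<eta>(2)
    by (simp add: power_int_minus power_int_inverse mult.commute)
  with \<eta>(1) assms show "v \<in> reversible_set S"
    unfolding reversible_set_def by (auto intro!: exI[of _ "inverse \<eta>"])
qed

text \<open>The action multiplies the ratio of b to a by \<open>\<eta>\<close> to the power
  \<open>2 * (p - q)\<close>, so \<open>\<gamma>\<close> is replaced by
  \<open>\<gamma> * \<eta> * \<eta>\<close>.\<close>

lemma U_reversible:
  assumes v: "v \<in> reversible_set S" and \<eta>: "\<eta> \<noteq> 0"
  shows "U S \<eta> v \<in> reversible_set S"
proof -
  have vp: "v \<in> params S" using v by (simp add: reversible_set_def)
  obtain \<gamma> where \<gamma>: "\<gamma> \<noteq> 0"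
    "\<And>k. k < length S \<Longrightarrow> b_coeff S v k = \<gamma> powi pq_diff S k * a_coeff S v k"
    using v by (auto simp: reversible_set_def)
  have "b_coeff S (U S \<eta> v) k = (\<gamma> * \<eta> * \<eta>) powi pq_diff S k * a_coeff S (U S \<eta> v) k"
    if "k < length S" for k
    using \<gamma> \<eta> vp that
    by (simp add: coeff_U power_int_mult_distrib power_int_minus field_simps)
  with \<gamma>(1) \<eta> vp show ?thesis
    unfolding reversible_set_def by (auto simp: U_closed intro!: exI[of _ "\<gamma> * \<eta> * \<eta>"])
qed

lemma U_orbits_eq: "U_orbits S = (\<lambda>v. {U S \<eta> v | \<eta>. \<eta> \<noteq> 0}) ` params S"
  unfolding U_orbits_def orbits_def orbit_def U_group_def by auto

lemma in_own_orbit: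
  assumes "v \<in> params S"
  shows "v \<in> {U S \<eta> v | \<eta>. \<eta> \<noteq> 0}"
  using assms by (auto intro!: exI[of _ 1] simp: U_one)

text \<open>Two points of an orbit differ by some \<open>U S \<eta>\<close>, which preserves
  reversibility. This is the dichotomy between the two kinds of orbits.\<close>

lemma orbit_subset_reversible:
  assumes X: "X \<in> U_orbits S" and v: "v \<in> X" "v \<in> reversible_set S"
  shows "X \<subseteq> reversible_set S"
proof
  fix w assume "w \<in> X"
  with X v(1) obtain u \<eta> \<theta> where u: "u \<in> params S" "\<eta> \<noteq> 0" "\<theta> \<noteq> 0" "v = U S \<eta> u" "w = U S \<theta> u"
    by (auto simp: U_orbits_eq)
  then have "w = U S (\<theta> * inverse \<eta>) v"
    by (simp add: U_U mult.assoc)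
  then show "w \<in> reversible_set S"
    using u v(2) by (simp add: U_reversible)
qed

lemma involution_invariant_iff:
  assumes X: "X \<in> U_orbits S"
  shows "involution_invariant X \<longleftrightarrow> X \<subseteq> reversible_set S"
proof -
  obtain u where u: "u \<in> params S" "X = {U S \<eta> u | \<eta>. \<eta> \<noteq> 0}"
    using X by (auto simp: U_orbits_eq)
  have "rev_vec v \<in> X \<longleftrightarrow> v \<in> reversible_set S" if v: "v \<in> X" for v
  proof -
    obtain \<theta> where \<theta>: "\<theta> \<noteq> 0" "v = U S \<theta> u" using v u(2) by auto
    \<comment> \<open>Any point of the orbit may replace the base point \<open>u\<close>; then
      \<open>rev_vec v \<in> X\<close> becomes the reversibility criterion for
      \<open>v\<close>.\<close>
    have "X = {U S \<eta> v | \<eta>. \<eta> \<noteq> 0}"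
    proof
      show "X \<subseteq> {U S \<eta> v | \<eta>. \<eta> \<noteq> 0}"
      proof
        fix w assume "w \<in> X"
        then obtain \<eta> where "\<eta> \<noteq> 0" "w = U S \<eta> u" using u by auto
        then have "\<eta> * inverse \<theta> \<noteq> 0" "w = U S (\<eta> * inverse \<theta>) v"
          using \<theta> u by (auto simp: U_U mult.assoc)
        then show "w \<in> {U S \<eta> v | \<eta>. \<eta> \<noteq> 0}" by blast
      qed
      show "{U S \<eta> v | \<eta>. \<eta> \<noteq> 0} \<subseteq> X"
      proof
        fix w assume "w \<in> {U S \<eta> v | \<eta>. \<eta> \<noteq> 0}"
        then obtain \<eta> where "\<eta> \<noteq> 0" "w = U S \<eta> v" by auto
        then have "\<eta> * \<theta> \<noteq> 0" "w = U S (\<eta> * \<theta>) u"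
          using \<theta> u by (auto simp: U_U)
        then show "w \<in> X" using u(2) by blast
      qed
    qed
    then show ?thesis
      using reversible_iff_rev_in_orbit[of v S] \<theta> u(1) by (auto simp: U_closed)
  qed
  then show ?thesis by (auto simp: involution_invariant_def)
qed

lemma Union_reversible_orbits:
  "\<Union> {X \<in> U_orbits S. X \<subseteq> reversible_set S} = reversible_set S"
proof
  show "reversible_set S \<subseteq> \<Union> {X \<in> U_orbits S. X \<subseteq> reversible_set S}"
  proof
    fix v assume v: "v \<in> reversible_set S"
    then have vp: "v \<in> params S" by (simp add: reversible_set_def)
    let ?X = "{U S \<eta> v | \<eta>. \<eta> \<noteq> 0}"
    have X: "?X \<in> U_orbits S" using vp by (auto simp: U_orbits_eq)
    with orbit_subset_reversible[OF X in_own_orbit[OF vp] v] in_own_orbit[OF vp]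
    show "v \<in> \<Union> {X \<in> U_orbits S. X \<subseteq> reversible_set S}" by blast
  qed
qed blast


section \<open>The variety of the Sibirsky ideal\<close>

text \<open>Folds the index range so that the a-entry and the b-entry of a pair meet. The general
  setting covers sums and products at once.\<close>

lemma (in comm_monoid_set) double_lessThan_split:
  fixes g :: "nat \<Rightarrow> 'a" and l :: nat
  shows "F g {..<2 * l} = F (\<lambda>k. g k \<^bold>* g (2 * l - 1 - k)) {..<l}"
proof -
  have "F g {..<2 * l} = F g {..<l} \<^bold>* F g {l..<2 * l}"
    by (subst union_disjoint[symmetric]) (auto intro: arg_cong[where f = "F g"])
  also have "F g {l..<2 * l} = F (\<lambda>k. g (2 * l - 1 - k)) {..<l}"
    by (rule reindex_bij_witness[where i = "\<lambda>k. 2 * l - 1 - k" and j = "\<lambda>k. 2 * l - 1 - k"]) auto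
  finally show ?thesis by (simp add: distrib)
qed

text \<open>The entries of \<open>zeta S\<close> change sign under reversal of positions, so
  membership balances the weights of the a-part and the b-part.\<close>

lemma M_monoid_iff:
  assumes "\<nu> \<in> carrier_vec (2 * length S)"
  shows "\<nu> \<in> M_monoid S \<longleftrightarrow> (\<Sum>k<length S. pq_diff S k * int (\<nu> $ k)) =
    (\<Sum>k<length S. pq_diff S k * int (\<nu> $ (2 * length S - 1 - k)))"
proof -
  have "zeta S \<bullet> map_vec int \<nu> = (\<Sum>i<2 * length S. zeta S $ i * int (\<nu> $ i))"
    using assms by (auto simp: scalar_prod_def atLeast0LessThan intro!: sum.cong)
  also have "\<dots> = (\<Sum>k<length S. pq_diff S k * int (\<nu> $ k) -
      pq_diff S k * int (\<nu> $ (2 * length S - 1 - k)))"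
    unfolding sum.double_lessThan_split
    by (intro sum.cong refl) (auto simp: zeta_def ab_vec_def)
  finally show ?thesis
    using assms by (simp add: M_monoid_def sum_subtractf)
qed

lemma mem_sibirsky_variety:
  "v \<in> variety (2 * length S) (sibirsky_ideal S) \<longleftrightarrow> v \<in> params S \<and>
    (\<forall>\<nu> \<in> M_monoid S. monomial_value (2 * length S) (\<lambda>i. \<nu> $ i) v =
       monomial_value (2 * length S) (\<lambda>i. \<nu> $ (2 * length S - 1 - i)) v)"
proof -
  have "eval_mpoly (monomial \<nu> - monomial (rev_vec \<nu>)) v =
      monomial_value (2 * length S) (\<lambda>i. \<nu> $ i) v -
      monomial_value (2 * length S) (\<lambda>i. \<nu> $ (2 * length S - 1 - i)) v" if "\<nu> \<in> M_monoid S" for \<nu>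
    using that
    by (auto simp: M_monoid_def eval_mpoly_diff eval_monomial rev_vec_def monomial_value_def)
  then show ?thesis
    unfolding sibirsky_ideal_def variety_genideal[OF sibirsky_generators]
    by (auto simp: variety_def params_def)
qed

lemma monomial_value_split:
  "monomial_value (2 * length S) e v =
    (\<Prod>k<length S. a_coeff S v k ^ e k * b_coeff S v k ^ e (2 * length S - 1 - k))"
  unfolding monomial_value_def prod.double_lessThan_split by (simp add: a_coeff_def b_coeff_def)

lemma prod_power_int:
  fixes x :: "'a::field"
  assumes "x \<noteq> 0"
  shows "(\<Prod>k\<in>A. x powi f k) = x powi (\<Sum>k\<in>A. f k)"
  by (induction A rule: infinite_finite_induct) (simp_all add: assms power_int_add)

text \<open>Substituting for the b-coefficients leaves only the exponent sums over reflected
  positions and one weighted sum as exponent of \<open>\<gamma>\<close>.\<close>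

lemma monomial_value_reversible:
  assumes "\<gamma> \<noteq> 0" "\<And>k. k < length S \<Longrightarrow> b_coeff S v k = \<gamma> powi pq_diff S k * a_coeff S v k"
  shows "monomial_value (2 * length S) e v =
    (\<Prod>k<length S. a_coeff S v k ^ (e k + e (2 * length S - 1 - k))) *
    \<gamma> powi (\<Sum>k<length S. pq_diff S k * int (e (2 * length S - 1 - k)))"
  unfolding monomial_value_split prod_power_int[OF assms(1), symmetric] prod.distrib[symmetric]
  by (intro prod.cong refl)
    (simp add: assms(2) power_mult_distrib power_add power_int_mult mult_ac)

text \<open>Reversing \<open>\<nu>\<close> keeps the sums over reflected positions and exchanges its
  a-weight with its b-weight, which are equal for \<open>\<nu>\<close> in
  \<open>M_monoid S\<close>.\<close>

lemma reversible_subset_sibirsky_variety: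
  "reversible_set S \<subseteq> variety (2 * length S) (sibirsky_ideal S)"
proof
  fix v assume v: "v \<in> reversible_set S"
  then obtain \<gamma> where \<gamma>: "\<gamma> \<noteq> 0"
    "\<And>k. k < length S \<Longrightarrow> b_coeff S v k = \<gamma> powi pq_diff S k * a_coeff S v k"
    by (auto simp: reversible_set_def)
  have "monomial_value (2 * length S) (\<lambda>i. \<nu> $ i) v =
      monomial_value (2 * length S) (\<lambda>i. \<nu> $ (2 * length S - 1 - i)) v" if "\<nu> \<in> M_monoid S" for \<nu>
  proof -
    have "\<nu> \<in> carrier_vec (2 * length S)" using that by (simp add: M_monoid_def)
    then have "(\<Sum>k<length S. pq_diff S k * int (\<nu> $ k)) =
        (\<Sum>k<length S. pq_diff S k * int (\<nu> $ (2 * length S - 1 - k)))"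
      using that M_monoid_iff by blast
    moreover have "(\<Sum>k<length S. pq_diff S k * int (\<nu> $ (2 * length S - 1 - (2 * length S - 1 - k)))) =
        (\<Sum>k<length S. pq_diff S k * int (\<nu> $ k))"
      by (intro sum.cong) auto
    moreover have "(\<Prod>k<length S. a_coeff S v k ^ (\<nu> $ k + \<nu> $ (2 * length S - 1 - k))) =
        (\<Prod>k<length S. a_coeff S v k ^ (\<nu> $ (2 * length S - 1 - k) +
          \<nu> $ (2 * length S - 1 - (2 * length S - 1 - k))))"
      by (intro prod.cong) (auto simp: add.commute)
    ultimately show ?thesis
      using monomial_value_reversible[OF \<gamma>(1), of S v] \<gamma>(2) by simp
  qed
  with v show "v \<in> variety (2 * length S) (sibirsky_ideal S)"
    by (auto simp: mem_sibirsky_variety reversible_set_def)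
qed

section \<open>Monomials that agree on all reversible systems\<close>

lemma powi_two_inject:
  fixes m n :: int
  assumes "(2::complex) powi m = 2 powi n"
  shows "m = n"
proof -
  have "(2::real) powi m = 2 powi n"
    using arg_cong[OF assms, of norm] by (simp add: norm_power_int)
  then show ?thesis
    using power_int_strict_increasing[of m n "2::real"] power_int_strict_increasing[of n m "2::real"]
    by (cases m n rule: linorder_cases) auto
qed

lemma ab_vec_coeff:
  assumes "k < length S"
  shows "a_coeff S (ab_vec (length S) a b) k = a k" "b_coeff S (ab_vec (length S) a b) k = b k"
  using assms by (auto simp: a_coeff_def b_coeff_def ab_vec_def)

text \<open>
  The test points are the system with all \<open>a\<^sub>k = 1\<close> and \<open>\<gamma> = 2\<close>, and those with
  \<open>a\<^sub>k = b\<^sub>k = 2\<close> for one \<open>k\<close> and all other coefficients 1 (so \<open>\<gamma> = 1\<close>).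
\<close>

lemma exponents_if_equal_on_reversible:
  assumes eq: "\<And>u. u \<in> reversible_set S \<Longrightarrow>
      monomial_value (2 * length S) e u = monomial_value (2 * length S) d u"
  shows "(\<Sum>k<length S. pq_diff S k * int (e (2 * length S - 1 - k))) =
      (\<Sum>k<length S. pq_diff S k * int (d (2 * length S - 1 - k)))"
    and "k < length S \<Longrightarrow> e k + e (2 * length S - 1 - k) = d k + d (2 * length S - 1 - k)"
proof -
  let ?w = "\<lambda>a \<gamma>. ab_vec (length S) a (\<lambda>k. \<gamma> powi pq_diff S k * a k) :: complex vec"
  \<comment> \<open>The a-coefficients and \<open>\<gamma> \<noteq> 0\<close> can be chosen freely,
    and they determine a reversible system.\<close>
  have w: "(\<Prod>k<length S. a k ^ (e k + e (2 * length S - 1 - k))) *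
        \<gamma> powi (\<Sum>k<length S. pq_diff S k * int (e (2 * length S - 1 - k))) =
      (\<Prod>k<length S. a k ^ (d k + d (2 * length S - 1 - k))) *
        \<gamma> powi (\<Sum>k<length S. pq_diff S k * int (d (2 * length S - 1 - k)))"
    if "\<gamma> \<noteq> 0" for a :: "nat \<Rightarrow> complex" and \<gamma>
  proof -
    have "?w a \<gamma> \<in> reversible_set S"
      using that by (auto simp: reversible_set_def params_def ab_vec_coeff)
        (auto simp: ab_vec_def)
    from eq[OF this] show ?thesis
      by (simp add: monomial_value_reversible[OF that] ab_vec_coeff)
  qed
  show "(\<Sum>k<length S. pq_diff S k * int (e (2 * length S - 1 - k))) =
      (\<Sum>k<length S. pq_diff S k * int (d (2 * length S - 1 - k)))"
    using w[of 2 "\<lambda>_. 1"] by (intro powi_two_inject) simp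
  show "e k + e (2 * length S - 1 - k) = d k + d (2 * length S - 1 - k)" if k: "k < length S"
  proof -
    have prod: "(\<Prod>j<length S. (if j = k then 2 else 1) ^ h j) = (2::complex) ^ h k" for h
      using k by (simp add: if_distrib[of "\<lambda>x. x ^ _"] cong: if_cong)
    have "(2::complex) ^ (e k + e (2 * length S - 1 - k)) = 2 ^ (d k + d (2 * length S - 1 - k))"
      using w[of 1 "\<lambda>j. if j = k then 2 else 1"] by (simp add: prod)
    then have "(2::complex) powi int (e k + e (2 * length S - 1 - k)) =
        2 powi int (d k + d (2 * length S - 1 - k))"
      by (simp only: power_int_of_nat)
    then show ?thesis
      using powi_two_inject by (metis of_nat_eq_iff)
  qed
qed

text \<open>Agreement on reversible systems fixes the sums of exponents over reflected positions and
  the b-weight. These are just the conditions under which the two monomials differ by exchanging a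
  factor from \<open>M_monoid S\<close> for its reversal.\<close>

lemma monomial_values_agree_on_sibirsky_variety:
  assumes v: "v \<in> variety (2 * length S) (sibirsky_ideal S)"
    and eq: "\<And>u. u \<in> reversible_set S \<Longrightarrow>
      monomial_value (2 * length S) e u = monomial_value (2 * length S) d u"
  shows "monomial_value (2 * length S) e v = monomial_value (2 * length S) d v"
proof -
  let ?l = "length S"
  let ?r = "\<lambda>i. 2 * ?l - 1 - i"
  note E = exponents_if_equal_on_reversible[of S e d, OF eq]
  have sum_eq: "e i + e (?r i) = d i + d (?r i)" if "i < 2 * ?l" for i
  proof (cases "i < ?l")
    case False
    then have "?r i < ?l" "?r (?r i) = i" using that by auto
    then show ?thesis using E(2)[of "?r i"] by simp
  qed (rule E(2))
  text \<open>Cancelling the common factor leaves exponents \<open>e - d\<close> and \<open>d - e\<close> in truncated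
    subtraction, and these are reversals of each other.\<close>
  define \<nu> where "\<nu> = vec (2 * ?l) (\<lambda>i. e i - d i)"
  have rev: "\<nu> $ ?r i = d i - e i" if "i < 2 * ?l" for i
    using sum_eq[OF that] that by (auto simp: \<nu>_def)
  have "\<nu> \<in> M_monoid S"
  proof -
    have "(\<Sum>k<?l. pq_diff S k * int (\<nu> $ k)) - (\<Sum>k<?l. pq_diff S k * int (\<nu> $ ?r k)) =
        (\<Sum>k<?l. pq_diff S k * int (d (?r k)) - pq_diff S k * int (e (?r k)))"
      unfolding sum_subtractf[symmetric]
    proof (intro sum.cong refl)
      fix k assume "k \<in> {..<?l}"
      \<comment> \<open>Both sides equal \<open>e k - d k\<close> as integers: the two truncated
        differences recombine on the left, and \<open>sum_eq\<close> gives the right.\<close>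
      then have "int (\<nu> $ k) - int (\<nu> $ ?r k) = int (d (?r k)) - int (e (?r k))"
        using rev[of k] sum_eq[of k] by (cases "e k \<le> d k") (simp_all add: \<nu>_def)
      then show "pq_diff S k * int (\<nu> $ k) - pq_diff S k * int (\<nu> $ ?r k) =
          pq_diff S k * int (d (?r k)) - pq_diff S k * int (e (?r k))"
        by (metis right_diff_distrib)
    qed
    also have "\<dots> = 0" using E(1) by (simp add: sum_subtractf)
    finally show ?thesis by (subst M_monoid_iff) (auto simp: \<nu>_def)
  qed
  then have *: "monomial_value (2 * ?l) (\<lambda>i. \<nu> $ i) v = monomial_value (2 * ?l) (\<lambda>i. \<nu> $ ?r i) v"
    using v by (simp add: mem_sibirsky_variety)
  \<comment> \<open>Pointwise, \<open>e\<close> is \<open>min e d\<close> plus \<open>e - d\<close>,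
    and \<open>d\<close> is \<open>min e d\<close> plus \<open>d - e\<close>; the minimum is the
    common factor.\<close>
  have "monomial_value (2 * ?l) e v =
      monomial_value (2 * ?l) (\<lambda>i. min (e i) (d i)) v * monomial_value (2 * ?l) (\<lambda>i. \<nu> $ i) v"
    unfolding monomial_value_def prod.distrib[symmetric] power_add[symmetric]
    by (intro prod.cong refl arg_cong2[where f = power]) (auto simp: \<nu>_def)
  also have "\<dots> = monomial_value (2 * ?l) d v"
    unfolding * unfolding monomial_value_def prod.distrib[symmetric] power_add[symmetric]
    by (intro prod.cong refl arg_cong2[where f = power]) (use rev in auto)
  finally show ?thesis .
qed

text \<open>The parameters multiply: \<open>\<gamma>\<close> and \<open>\<delta>\<close> yield
  \<open>\<gamma> * \<delta>\<close>.\<close>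

lemma reversible_set_hadamard:
  assumes "u \<in> reversible_set S" "v \<in> reversible_set S"
  shows "hadamard u v \<in> reversible_set S"
proof -
  obtain \<gamma> where \<gamma>: "\<gamma> \<noteq> 0"
    "\<And>k. k < length S \<Longrightarrow> b_coeff S u k = \<gamma> powi pq_diff S k * a_coeff S u k"
    using assms(1) by (auto simp: reversible_set_def)
  obtain \<delta> where \<delta>: "\<delta> \<noteq> 0"
    "\<And>k. k < length S \<Longrightarrow> b_coeff S v k = \<delta> powi pq_diff S k * a_coeff S v k"
    using assms(2) by (auto simp: reversible_set_def)
  have dim: "dim_vec u = 2 * length S" using assms by (auto simp: reversible_set_def params_def)
  have h: "a_coeff S (hadamard u v) k = a_coeff S u k * a_coeff S v k"
    "b_coeff S (hadamard u v) k = b_coeff S u k * b_coeff S v k" if "k < length S" for k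
    using that dim by (auto simp: a_coeff_def b_coeff_def hadamard_def)
  have "\<forall>k<length S. b_coeff S (hadamard u v) k =
      (\<gamma> * \<delta>) powi pq_diff S k * a_coeff S (hadamard u v) k"
    by (simp add: h \<gamma>(2) \<delta>(2) power_int_mult_distrib)
  moreover have "hadamard u v \<in> params S"
    using dim by (auto simp: params_def hadamard_def)
  ultimately show ?thesis
    using \<gamma>(1) \<delta>(1) unfolding reversible_set_def by (auto intro!: exI[of _ "\<gamma> * \<delta>"])
qed

text \<open>One inclusion is minimality of the closure. For the other, every polynomial defining a
  variety around the reversible systems vanishes on their monoid, hence at each point where
  monomials agreeing on the monoid agree.\<close>

lemma sibirsky_variety_eq_closure:
  "variety (2 * length S) (sibirsky_ideal S) = zariski_closure (2 * length S) (reversible_set S)"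
proof
  interpret R: cring "mpoly_ring (2 * length S)" by (rule cring_mpoly_ring)
  have "is_variety (2 * length S) (variety (2 * length S) (sibirsky_ideal S))"
    using R.genideal_ideal[OF sibirsky_generators] by (auto simp: is_variety_def sibirsky_ideal_def)
  then show "zariski_closure (2 * length S) (reversible_set S) \<subseteq>
      variety (2 * length S) (sibirsky_ideal S)"
    unfolding zariski_closure_def by (intro hull_minimal reversible_subset_sibirsky_variety)
  show "variety (2 * length S) (sibirsky_ideal S) \<subseteq>
      zariski_closure (2 * length S) (reversible_set S)"
    unfolding zariski_closure_def hull_def
  proof (intro Inter_greatest, clarify)
    fix V v
    assume V: "is_variety (2 * length S) V" "reversible_set S \<subseteq> V"
      and v: "v \<in> variety (2 * length S) (sibirsky_ideal S)"
    obtain I where I: "ideal I (mpoly_ring (2 * length S))" "V = variety (2 * length S) I"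
      using V(1) by (auto simp: is_variety_def)
    have "eval_mpoly f v = 0" if f: "f \<in> I" for f
    proof (rule eval_mpoly_zero_if_zero_on_monoid[where T = "reversible_set S"])
      show "f \<in> carrier (mpoly_ring (2 * length S))"
        using f I(1) ideal.Icarr by fast
      show "vec (2 * length S) (\<lambda>_. 1) \<in> reversible_set S"
        by (auto simp: reversible_set_def params_def a_coeff_def b_coeff_def intro!: exI[of _ 1])
      show "eval_mpoly f u = 0" if "u \<in> reversible_set S" for u
        using that V(2) I(2) f by (auto simp: variety_def)
      show "reversible_set S \<subseteq> carrier_vec (2 * length S)"
        by (auto simp: reversible_set_def params_def)
    next
      fix e d
      assume "\<And>u. u \<in> reversible_set S \<Longrightarrow>
        monomial_value (2 * length S) e u = monomial_value (2 * length S) d u"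
      then show "monomial_value (2 * length S) e v = monomial_value (2 * length S) d v"
        by (rule monomial_values_agree_on_sibirsky_variety[OF v])
    qed (rule reversible_set_hadamard)
    then show "v \<in> V"
      using v I(2) by (auto simp: variety_def)
  qed
qed

theorem theorem3:
  fixes S :: "(int \<times> nat) list"
  assumes "distinct S"
    and "\<forall>(p, q) \<in> set S. p \<ge> -1 \<and> p + int q \<ge> 0"
  shows "(\<exists>R N. R \<union> N = U_orbits S \<and> R \<inter> N = {} \<and>
              \<Union> R = {v \<in> params S. time_reversible S v} \<and>
              (\<forall>v \<in> \<Union> N. \<not> time_reversible S v)) \<and>
         variety (2 * length S) (sibirsky_ideal S) =
           zariski_closure (2 * length S) (\<Union> {X \<in> U_orbits S. involution_invariant X})"
proof
  \<comment> \<open>The reversible class consists of the orbits inside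
    \<open>reversible_set S\<close>; by the dichotomy, the remaining orbits do not meet this
    set.\<close>
  let ?R = "{X \<in> U_orbits S. X \<subseteq> reversible_set S}"
  have "\<not> time_reversible S v" if X: "X \<in> U_orbits S - ?R" and v: "v \<in> X" for X v
  proof
    assume "time_reversible S v"
    moreover have "v \<in> params S" using X v by (auto simp: U_orbits_eq U_closed)
    ultimately have "v \<in> reversible_set S"
      using Collect_time_reversible[OF assms] by blast
    then show False using X v orbit_subset_reversible[of X S v] by blast
  qed
  then show "\<exists>R N. R \<union> N = U_orbits S \<and> R \<inter> N = {} \<and>
      \<Union> R = {v \<in> params S. time_reversible S v} \<and> (\<forall>v \<in> \<Union> N. \<not> time_reversible S v)"
    by (intro exI[of _ ?R] exI[of _ "U_orbits S - ?R"])
      (auto simp only: Collect_time_reversible[OF assms] Union_reversible_orbits)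
  have "{X \<in> U_orbits S. involution_invariant X} = ?R"
    using involution_invariant_iff by blast
  then show "variety (2 * length S) (sibirsky_ideal S) =
      zariski_closure (2 * length S) (\<Union> {X \<in> U_orbits S. involution_invariant X})"
    by (simp add: Union_reversible_orbits sibirsky_variety_eq_closure)
qed

end
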